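(* Let $R$ be a factorial domain, $f\in{\rm Int}(R)^{\bullet}$, $\mathcal{S}$ a system of representatives of $\mathcal{A}([\![f]\!])\setminus R$, $p$ a constant atom of $[\![f]\!]$, and $A\subseteq[\![f]\!]$. (1) $A$ is $p$-compatible if and only if $(A\cup\{p\})_{v_{[\![f]\!]}}\subsetneq[\![f]\!]$. (2) $\{P\in\mathfrak{X}([\![f]\!])\mid p\in P\}=\{(Q\cup\{p\})[\![f]\!]\mid Q\subseteq\mathcal{S},\ Q\text{ is maximal }p\text{-compatible in }\mathcal{S}\}$.
   Context: Monoids are commutative and cancellative with identity; for a domain $D$, $D^{\bullet}=D\setminus\{0\}$ is a multiplicative monoid; $\mathcal{A}(\cdot)$ denotes the set of atoms. For a monoid $H$ with quotient group $L$: an $s$-ideal is a subset $I\subseteq H$ with $IH=I$ (the empty set is allowed); it is prime if $I\neq H$ and $H\setminus I$ is a submonoid. $\mathfrak{X}(H)$ is the set of minimal nonempty prime $s$-ideals of $H$. For $Y\subseteq L$ put $Y^{-1}=\{z\in L\mid zY\subseteq H\}$ and $Y_{v_H}=(Y^{-1})^{-1}$. A system of representatives of $E\subseteq H$ is a subset $F\subseteq E$ such that every $x\in E$ is associated (equal up to a unit of $H$) to exactly one $y\in F$. With $K$ a quotient field of $R$ and $X$ an indeterminate over $K$, ${\rm Int}(R)=\{g\in K[X]\mid g(x)\in R\text{ for all }x\in R\}$. For $f\in{\rm Int}(R)^{\bullet}$, $[\![f]\!]=\{g\in{\rm Int}(R)^{\bullet}\mid g\text{ divides }f^k\text{ in }{\rm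 Int}(R)\text{ for some }k\in\mathbb{N}_0\}$; it is known that $[\![f]\!]$ is a Krull monoid. The constant atoms of $[\![f]\!]$ are the elements of $\mathcal{A}([\![f]\!])\cap R$. Fix a system $\mathcal{Q}$ of representatives (up to associates) of the prime elements of $R$; for $q\in\mathcal{Q}$, $\mathrm{v}_q:R\to\mathbb{N}_0\cup\{\infty\}$ is the $q$-adic valuation, and $d:{\rm Int}(R)^{\bullet}\to R^{\bullet}$ is defined by $d(g)=\prod_{q\in\mathcal{Q}}q^{\min\{\mathrm{v}_q(g(c))\mid c\in R\}}$. Let $a\in[\![f]\!]\cap R$ and $A\subseteq B\subseteq[\![f]\!]$. $A$ is $a$-compatible if there is some $w\in[\![f]\!]$ such that $a$ divides $\frac{d(uw)}{d(w)}$ in $R$ for all $u\in A$. $A$ is maximal $a$-compatible in $B$ if $A$ is maximal with respect to inclusion among the $a$-compatible subsets of $B$. *)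

theory Defs
  imports
    "HOL-Computational_Algebra.Computational_Algebra"
    "HOL-Library.Set_Algebras"
    "HOL-Library.Extended_Nat"
begin

text \<open>
  A (commutative cancellative) monoid is given by its carrier, a multiplicatively closed subset
  \<open>H\<close> of \<open>D - {0}\<close> containing \<open>1\<close>, for an integral domain \<open>D\<close>. Its quotient group then lives in
  the fraction field of \<open>D\<close>. Products of sets are the elementwise products of
  \<^theory>\<open>HOL-Library.Set_Algebras\<close>.
\<close>

subsection \<open>Monoids\<close>

definition divides_in :: "'b::idom set \<Rightarrow> 'b \<Rightarrow> 'b \<Rightarrow> bool" where
  "divides_in H x y \<longleftrightarrow> (\<exists>z\<in>H. y = x * z)"

definition units_of :: "'b::idom set \<Rightarrow> 'b set" where
  "units_of H = {u \<in> H. \<exists>v\<in>H. u * v = 1}"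

definition atoms_of :: "'b::idom set \<Rightarrow> 'b set" where
  "atoms_of H = {a \<in> H. a \<notin> units_of H \<and>
     (\<forall>x\<in>H. \<forall>y\<in>H. a = x * y \<longrightarrow> x \<in> units_of H \<or> y \<in> units_of H)}"

definition associated_in :: "'b::idom set \<Rightarrow> 'b \<Rightarrow> 'b \<Rightarrow> bool" where
  "associated_in H x y \<longleftrightarrow> (\<exists>u\<in>units_of H. y = x * u)"

definition system_of_reps :: "'b::idom set \<Rightarrow> 'b set \<Rightarrow> 'b set \<Rightarrow> bool" where
  "system_of_reps H E F \<longleftrightarrow> F \<subseteq> E \<and> (\<forall>x\<in>E. \<exists>!y. y \<in> F \<and> associated_in H x y)"

definition s_ideal :: "'b::idom set \<Rightarrow> 'b set \<Rightarrow> bool" where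
  "s_ideal H I \<longleftrightarrow> I \<subseteq> H \<and> I * H = I"

definition prime_s_ideal :: "'b::idom set \<Rightarrow> 'b set \<Rightarrow> bool" where
  "prime_s_ideal H P \<longleftrightarrow> s_ideal H P \<and> P \<noteq> H \<and>
     1 \<in> H - P \<and> (\<forall>x\<in>H - P. \<forall>y\<in>H - P. x * y \<in> H - P)"

definition min_primes :: "'b::idom set \<Rightarrow> 'b set set" where
  "min_primes H = {P. prime_s_ideal H P \<and> P \<noteq> {} \<and>
     (\<forall>P'. prime_s_ideal H P' \<and> P' \<noteq> {} \<and> P' \<subseteq> P \<longrightarrow> P' = P)}"

definition quotient_group :: "'b::idom set \<Rightarrow> 'b fract set" where
  "quotient_group H = {to_fract x / to_fract y | x y. x \<in> H \<and> y \<in> H}"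

definition monoid_inverse :: "'b::idom set \<Rightarrow> 'b fract set \<Rightarrow> 'b fract set" where
  "monoid_inverse H Y = {z \<in> quotient_group H. z *o Y \<subseteq> to_fract ` H}"

definition v_closure :: "'b::idom set \<Rightarrow> 'b fract set \<Rightarrow> 'b fract set" where
  "v_closure H Y = monoid_inverse H (monoid_inverse H Y)"

subsection \<open>Integer-valued polynomials\<close>

abbreviation const :: "'a::idom \<Rightarrow> 'a fract poly" where
  "const r \<equiv> [:to_fract r:]"

definition int_valued :: "'a::idom fract poly set" where
  "int_valued = {g. \<forall>x::'a. poly g (to_fract x) \<in> range to_fract}"

text \<open>The divisor-closed submonoid of \<open>int_valued - {0}\<close> generated by \<open>f\<close>.\<close>

definition div_closed :: "'a::idom fract poly \<Rightarrow> 'a fract poly set" where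
  "div_closed f = {g \<in> int_valued - {0}. \<exists>k::nat. divides_in int_valued g (f ^ k)}"

text \<open>The value \<open>g c\<close> as an element of the domain itself; meaningful for \<open>g \<in> int_valued\<close>.\<close>

definition value_at :: "'a::idom fract poly \<Rightarrow> 'a \<Rightarrow> 'a" where
  "value_at g c = (THE r. to_fract r = poly g (to_fract c))"

text \<open>The library's \<^const>\<open>multiplicity\<close> is \<open>0\<close> at \<open>0\<close>, where the valuation is infinite.\<close>

definition val :: "'a::factorial_semiring \<Rightarrow> 'a \<Rightarrow> enat" where
  "val q x = (if x = 0 then \<infinity> else enat (multiplicity q x))"

definition min_val :: "'a::{factorial_semiring, idom} \<Rightarrow> 'a fract poly \<Rightarrow> nat" where
  "min_val q g = the_enat (INF c. val q (value_at g c))"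

text \<open>
  For \<open>g \<in> int_valued - {0}\<close> the minimum is finite for every \<open>q \<in> \<Q>\<close>, and nonzero for only
  finitely many of them: if there is a prime element, the domain is infinite, so \<open>g c \<noteq> 0\<close> for
  some \<open>c\<close>. Restricting to these factors makes the product a finite one.
\<close>

definition fixed_div :: "'a::{factorial_semiring, idom} set \<Rightarrow> 'a fract poly \<Rightarrow> 'a" where
  "fixed_div \<Q> g = (\<Prod>q\<in>{q \<in> \<Q>. min_val q g \<noteq> 0}. q ^ min_val q g)"

text \<open>
  The division is exact: for \<open>u\<close>, \<open>w\<close> in \<open>int_valued - {0}\<close>, \<open>fixed_div \<Q> w\<close> is nonzero and
  divides \<open>fixed_div \<Q> (u * w)\<close>, since the minimum of a sum is at least the sum of the minima.
\<close>

definition compatible ::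
  "'a::{factorial_semiring, idom} set \<Rightarrow> 'a fract poly \<Rightarrow> 'a \<Rightarrow> 'a fract poly set \<Rightarrow> bool" where
  "compatible \<Q> f a A \<longleftrightarrow>
     (\<exists>w\<in>div_closed f. \<forall>u\<in>A. a dvd fixed_div \<Q> (u * w) div fixed_div \<Q> w)"

definition max_compatible ::
  "'a::{factorial_semiring, idom} set \<Rightarrow> 'a fract poly \<Rightarrow> 'a \<Rightarrow> 'a fract poly set \<Rightarrow>
    'a fract poly set \<Rightarrow> bool" where
  "max_compatible \<Q> f a B A \<longleftrightarrow> A \<subseteq> B \<and> compatible \<Q> f a A \<and>
     (\<forall>A'. A \<subseteq> A' \<and> A' \<subseteq> B \<and> compatible \<Q> f a A' \<longrightarrow> A' = A)"

end

theory Submission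
  imports Defs
begin

text \<open>
  A constant atom \<open>p\<close> is a prime element of \<open>R\<close>, and \<open>p\<close> divides \<open>w\<close> in \<open>H = div_closed f\<close> iff it
  divides all values of \<open>w\<close>. Hence a set is \<open>p\<close>-compatible iff it lies in some conductor
  \<open>(p : w) = {u \<in> H. p dvd u * w}\<close> with \<open>w\<close> not divisible by \<open>p\<close>; since \<open>w / p\<close> is then an element
  of \<open>(A \<union> {p})\<^sup>-\<^sup>1\<close> outside \<open>H\<close>, this gives the first equivalence.

  For the second, only finitely many points are needed to test whether \<open>p\<close> divides all values of
  an element of \<open>H\<close>: by Dickson's lemma, applied to the \<open>p\<close>-adic valuations of the irreducible
  factors of \<open>f\<close> at the points of \<open>R\<close>. So there are only finitely many conductors, each proper one
  is contained in a prime one, and every prime containing \<open>p\<close> contains a prime one. A prime conductor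
  is a minimal prime, because \<open>p\<^sup>n\<close> cannot divide \<open>e * w\<^sup>n\<close> for all \<open>n\<close>. Thus the
  minimal primes over \<open>p\<close> are the prime conductors, and these are generated by their atoms.
\<close>

section \<open>Dickson's lemma and valuations\<close>

text \<open>Induction on the index set. A finite \<open>Y\<close> handles the coordinates in
  \<open>I\<close> for the points with finite coordinate \<open>i\<close>, and \<open>N\<close>
  bounds coordinate \<open>i\<close> on \<open>Y\<close>. Points with
  \<open>N \<le> v i x < \<infinity>\<close> are therefore dominated by \<open>Y\<close> in every
  coordinate. The remaining points lie in finitely many slices on which coordinate \<open>i\<close>
  is constant.\<close>

lemma dickson_enat:
  fixes v :: "'i \<Rightarrow> 'x \<Rightarrow> enat"
  assumes "finite I"
  shows "\<exists>Y\<subseteq>X. finite Y \<and> (\<forall>x\<in>X. \<exists>y\<in>Y. \<forall>i\<in>I. v i y \<le> v i x)"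
  using assms
proof (induction I arbitrary: X rule: finite_induct)
  case empty
  show ?case
  proof (cases "X = {}")
    case False
    then obtain x where "x \<in> X" by auto
    then show ?thesis by (intro exI[of _ "{x}"]) auto
  qed auto
next
  case (insert i I)
  let ?W = "\<lambda>k. {x \<in> X. v i x = k}"
  from insert.IH have "\<forall>k. \<exists>Y\<subseteq>?W k. finite Y \<and> (\<forall>x\<in>?W k. \<exists>y\<in>Y. \<forall>i\<in>I. v i y \<le> v i x)"
    by blast
  then obtain Z where Z: "\<And>k. Z k \<subseteq> ?W k" "\<And>k. finite (Z k)"
    "\<And>k x. x \<in> ?W k \<Longrightarrow> \<exists>y\<in>Z k. \<forall>i\<in>I. v i y \<le> v i x"
    by metis
  \<comment> \<open>Infinite values are left out so that coordinate \<open>i\<close> is bounded on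
    \<open>Y\<close>; they form a slice of their own.\<close>
  from insert.IH[of "{x \<in> X. v i x \<noteq> \<infinity>}"] obtain Y where
    Y: "Y \<subseteq> {x \<in> X. v i x \<noteq> \<infinity>}" "finite Y"
      "\<And>x. x \<in> X \<Longrightarrow> v i x \<noteq> \<infinity> \<Longrightarrow> \<exists>y\<in>Y. \<forall>i\<in>I. v i y \<le> v i x"
    by blast
  obtain N where N: "\<And>y. y \<in> Y \<Longrightarrow> v i y \<le> enat N"
  proof -
    have "finite ((\<lambda>y. the_enat (v i y)) ` Y)" using Y by blast
    then obtain N where "\<And>y. y \<in> Y \<Longrightarrow> the_enat (v i y) \<le> N"
      by (meson finite_nat_set_iff_bounded_le imageI)
    then have "v i y \<le> enat N" if "y \<in> Y" for y
      using Y(1) that by (cases "v i y") force+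
    then show thesis using that by blast
  qed
  let ?T = "Y \<union> Z \<infinity> \<union> (\<Union>k<N. Z (enat k))"
  have "\<exists>y\<in>?T. \<forall>j\<in>insert i I. v j y \<le> v j x" if x: "x \<in> X" for x
  proof (cases "v i x < enat N \<or> v i x = \<infinity>")
    case True
    then have "Z (v i x) \<subseteq> ?T" by (cases "v i x") auto
    moreover obtain y where "y \<in> Z (v i x)" "\<forall>j\<in>I. v j y \<le> v j x"
      using Z(3)[of x "v i x"] x by blast
    moreover from this have "v i y = v i x" using Z(1) by blast
    ultimately show ?thesis by (intro bexI[of _ y]) auto
  next
    case False
    then obtain y where "y \<in> Y" "\<forall>j\<in>I. v j y \<le> v j x" using Y(3)[OF x] by blast
    moreover from this have "v i y \<le> v i x" using N[of y] False by (meson leI order_trans)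
    ultimately show ?thesis by (intro bexI[of _ y]) auto
  qed
  moreover have "finite ?T" using Y(2) Z(2) by simp
  moreover have "?T \<subseteq> X" using Y(1) Z(1) by blast
  ultimately show ?case by blast
qed

lemma val_mult:
  fixes x y :: "'a::{factorial_semiring, idom}"
  assumes "prime_elem q"
  shows "val q (x * y) = val q x + val q y"
  using assms by (simp add: val_def prime_elem_multiplicity_mult_distrib)

lemma power_dvd_iff_le_val:
  fixes x :: "'a::factorial_semiring"
  assumes "prime_elem q"
  shows "q ^ n dvd x \<longleftrightarrow> enat n \<le> val q x"
  using assms by (simp add: val_def power_dvd_iff_le_multiplicity)

lemma val_prod_mset_mono:
  fixes h h' :: "'b \<Rightarrow> 'a::{factorial_semiring, idom}"
  assumes "prime_elem q" "\<And>g. g \<in># B \<Longrightarrow> val q (h g) \<le> val q (h' g)"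
  shows "val q (\<Prod>g\<in>#B. h g) \<le> val q (\<Prod>g\<in>#B. h' g)"
  using assms(2) by (induction B) (auto simp: val_mult[OF assms(1)] intro: add_mono)

section \<open>Polynomials: denominators and prime factors\<close>

lemma poly_diff_dvd:
  fixes h :: "'a::comm_ring_1 poly"
  shows "x - y dvd poly h x - poly h y"
proof (induction h)
  case (pCons a h)
  have "poly (pCons a h) x - poly (pCons a h) y = (x - y) * poly h x + y * (poly h x - poly h y)"
    by (simp add: algebra_simps)
  with pCons show ?case by simp
qed simp

lemma poly_map_to_fract [simp]: "poly (map_poly to_fract h) (to_fract x) = to_fract (poly h x)"
  by (induction h) (auto simp: map_poly_pCons)

lemma clear_denominators:
  fixes g :: "'a::idom fract poly"
  obtains b h where "b \<noteq> 0" "smult (to_fract b) g = map_poly to_fract h"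
proof (induction g arbitrary: thesis)
  case 0
  show ?case by (rule 0[of 1 0]) auto
next
  case (pCons c g)
  obtain b h where bh: "b \<noteq> 0" "smult (to_fract b) g = map_poly to_fract h"
    using pCons.IH by blast
  obtain r s where c: "c = to_fract r / to_fract s" "s \<noteq> 0"
    by (cases c) (auto simp: Fract_conv_to_fract)
  have "smult (to_fract (s * b)) (pCons c g) = map_poly to_fract (pCons (r * b) (smult s h))"
    using bh c by (simp add: map_poly_pCons flip: smult_smult)
  with bh c show ?case by (intro pCons.prems[of "s * b"]) auto
qed

text \<open>Each prime \<open>g\<close> in \<open>A\<close> divides \<open>x\<close> or
  \<open>y\<close> and can be cancelled there, which shortens the product. For \<open>B\<close> only
  the set of factors is controlled, since the test set below depends on which primes occur and not
  on how often.\<close>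

lemma dvd_prod_mset_primes:
  fixes x y :: "'a::idom"
  assumes "x * y = c * prod_mset A" "c dvd 1" "\<And>g. g \<in># A \<Longrightarrow> prime_elem g"
  shows "\<exists>d B. d dvd 1 \<and> set_mset B \<subseteq> set_mset A \<and> x = d * prod_mset B"
  using assms(1,3)
proof (induction A arbitrary: x y)
  case empty
  then show ?case using assms(2)
    by (intro exI[of _ x] exI[of _ "{#}"]) (auto dest: dvd_mult_left)
next
  case (add g A)
  have "prime_elem g" using add.prems by simp
  moreover have "g dvd x * y" using add.prems by simp
  ultimately consider "g dvd x" | "g dvd y" using prime_elem_dvd_mult_iff by blast
  then show ?case
  proof cases
    case 1
    then obtain x' where x': "x = g * x'" by auto
    with add.prems \<open>prime_elem g\<close> have "x' * y = c * prod_mset A"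
      by (auto simp: mult_ac)
    with add obtain d B where "d dvd 1" "set_mset B \<subseteq> set_mset A" "x' = d * prod_mset B"
      by (metis add_mset_add_single union_iff)
    then show ?thesis
      using x' by (intro exI[of _ d] exI[of _ "add_mset g B"]) (auto simp: mult_ac)
  next
    case 2
    then obtain y' where y': "y = g * y'" by auto
    with add.prems \<open>prime_elem g\<close> have "x * y' = c * prod_mset A"
      by (auto simp: mult_ac)
    with add obtain d B where "d dvd 1" "set_mset B \<subseteq> set_mset A" "x = d * prod_mset B"
      by (metis add_mset_add_single union_iff)
    then show ?thesis by auto
  qed
qed

text \<open>Over a field a nonzero nonunit has positive degree, so both factors of a proper
  factorization have smaller degree; irreducible polynomials are prime.\<close>

lemma field_poly_prime_decomposition:
  fixes g :: "'a::field poly"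
  assumes "g \<noteq> 0"
  shows "\<exists>d A. d dvd 1 \<and> (\<forall>h\<in>#A. prime_elem h) \<and> g = d * prod_mset A"
  using assms
proof (induction "degree g" arbitrary: g rule: less_induct)
  case less
  consider "g dvd 1" | "irreducible g" | x y where "g = x * y" "\<not> x dvd 1" "\<not> y dvd 1"
    using less.prems by (auto simp: irreducible_def)
  then show ?case
  proof cases
    case 1
    then show ?thesis by (intro exI[of _ g] exI[of _ "{#}"]) auto
  next
    case 2
    then show ?thesis
      by (intro exI[of _ 1] exI[of _ "{#g#}"]) (auto intro: field_poly_irreducible_imp_prime)
  next
    case 3
    with less.prems have nz: "x \<noteq> 0" "y \<noteq> 0" by auto
    with 3 have "degree x > 0" "degree y > 0" by (auto simp: is_unit_iff_degree)
    with nz 3 have "degree x < degree g" "degree y < degree g" by (auto simp: degree_mult_eq)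
    from less.hyps[OF this(1) nz(1)] obtain d A where
      x: "d dvd 1" "\<forall>h\<in>#A. prime_elem h" "x = d * prod_mset A" by blast
    from less.hyps[OF \<open>degree y < degree g\<close> nz(2)] obtain e B where
      y: "e dvd 1" "\<forall>h\<in>#B. prime_elem h" "y = e * prod_mset B" by blast
    from x y 3 have "g = (d * e) * prod_mset (A + B)" by (simp add: mult_ac)
    moreover have "d * e dvd 1" using mult_dvd_mono[OF x(1) y(1)] by simp
    moreover have "\<forall>h\<in>#A + B. prime_elem h" using x y by auto
    ultimately show ?thesis by blast
  qed
qed

subsection \<open>Values of integer-valued polynomials\<close>

lemma value_at_eq:
  "g \<in> int_valued \<Longrightarrow> to_fract (value_at g c) = poly g (to_fract c)"
  by (auto simp: int_valued_def value_at_def dest!: spec[of _ c])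

lemma value_atI: "poly g (to_fract c) = to_fract r \<Longrightarrow> value_at g c = r"
  by (simp add: value_at_def)

lemma int_valued_mult: "g \<in> int_valued \<Longrightarrow> h \<in> int_valued \<Longrightarrow> g * h \<in> int_valued"
  by (auto simp: int_valued_def image_def) (metis to_fract_mult)

lemma int_valued_const: "const r \<in> int_valued"
  by (simp add: int_valued_def)

lemma int_valued_1: "1 \<in> int_valued"
  using int_valued_const[of 1] by (simp add: one_pCons)

lemma int_valued_power: "g \<in> int_valued \<Longrightarrow> g ^ n \<in> int_valued"
  by (induction n) (auto intro: int_valued_mult int_valued_1)

lemma value_at_mult:
  "g \<in> int_valued \<Longrightarrow> h \<in> int_valued \<Longrightarrow> value_at (g * h) c = value_at g c * value_at h c"
  by (intro value_atI) (simp add: value_at_eq)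

lemma value_at_const [simp]: "value_at (const r) c = r"
  by (intro value_atI) simp

lemma value_at_1 [simp]: "value_at 1 c = 1"
  by (intro value_atI) simp

lemma value_at_power: "g \<in> int_valued \<Longrightarrow> value_at (g ^ n) c = value_at g c ^ n"
  by (induction n) (auto simp: value_at_mult int_valued_power)

lemma value_at_eq_0_iff: "g \<in> int_valued \<Longrightarrow> value_at g c = 0 \<longleftrightarrow> poly g (to_fract c) = 0"
  by (metis value_at_eq to_fract_eq_0_iff)

text \<open>The powers of a prime element are pairwise distinct, so the points
  \<open>x + d * q ^ n\<close> form an infinite set, whereas \<open>e\<close> has only finitely many
  roots.\<close>

lemma ex_nonroot_on_line:
  fixes q d x :: "'a::{factorial_semiring, idom}"
  assumes "prime_elem q" "d \<noteq> 0" "e \<noteq> 0"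
  shows "\<exists>z. poly e (to_fract (x + d * z)) \<noteq> 0"
proof (rule ccontr)
  assume "\<not> ?thesis"
  then have "range (\<lambda>n. to_fract (x + d * q ^ n)) \<subseteq> {t. poly e t = 0}" by auto
  moreover have "finite {t. poly e t = 0}" using assms(3) by (rule poly_roots_finite)
  moreover have "inj (\<lambda>n. to_fract (x + d * q ^ n))"
  proof (rule injI)
    fix m n assume "to_fract (x + d * q ^ m) = to_fract (x + d * q ^ n)"
    then have "q ^ m = q ^ n" using assms(2) by (simp del: to_fract_add to_fract_mult)
    then show "m = n" using multiplicity_prime_power[OF assms(1)] by metis
  qed
  ultimately show False using finite_subset range_inj_infinite by blast
qed

lemma ex_nonroot:
  fixes q :: "'a::{factorial_semiring, idom}"
  assumes "prime_elem q" "g \<in> int_valued" "g \<noteq> 0"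
  shows "\<exists>x :: 'a. value_at g x \<noteq> 0"
  using ex_nonroot_on_line[OF assms(1), of 1 g 0] assms by (auto simp: value_at_eq_0_iff)

text \<open>Move \<open>x\<close> along \<open>x + b p z\<close>, where \<open>b\<close> clears the denominators of \<open>w\<close>: this fixes \<open>w x\<close> modulo \<open>p\<close>.\<close>

lemma ex_not_dvd_nonroot:
  fixes p :: "'a::{factorial_semiring, idom}"
  assumes p: "prime_elem p" and w: "w \<in> int_valued" "\<not> p dvd value_at w x"
    and e: "e \<in> int_valued" "e \<noteq> 0"
  shows "\<exists>y. \<not> p dvd value_at w y \<and> value_at e y \<noteq> 0"
proof -
  obtain b h where bh: "b \<noteq> 0" "smult (to_fract b) w = map_poly to_fract h"
    by (rule clear_denominators)
  have h: "b * value_at w y = poly h y" for y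
  proof -
    have "to_fract (b * value_at w y) = poly (smult (to_fract b) w) (to_fract y)"
      using w by (simp add: value_at_eq)
    then show ?thesis unfolding bh poly_map_to_fract to_fract_eq_iff .
  qed
  obtain z where z: "poly e (to_fract (x + (b * p) * z)) \<noteq> 0"
    using ex_nonroot_on_line[OF p _ e(2), of "b * p"] bh p by auto
  let ?y = "x + (b * p) * z"
  have "b * p * z dvd b * (value_at w ?y - value_at w x)"
    using poly_diff_dvd[of ?y x h] by (simp add: right_diff_distrib h)
  then have "b * p dvd b * (value_at w ?y - value_at w x)" by (rule dvd_mult_left)
  then have "p dvd value_at w ?y - value_at w x" using bh by simp
  with w(2) have "\<not> p dvd value_at w ?y"
    using dvd_diff[of p "value_at w ?y" "value_at w ?y - value_at w x"] by auto
  with z e show ?thesis using value_at_eq_0_iff by blast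
qed

text \<open>Up to a constant, every divisor \<open>u\<close> of a power of \<open>f\<close> is a
  product of prime factors of \<open>f\<close>. After clearing denominators, the valuation of
  \<open>u x\<close> is thus a sum of valuations of these factors at \<open>x\<close>, up to terms
  independent of \<open>x\<close>. Dickson's lemma gives a finite \<open>Y\<close> such that each
  \<open>x\<close> is dominated in all factors at once by some \<open>y \<in> Y\<close>; then the
  valuation of \<open>u y\<close> is at most that of \<open>u x\<close>. The set \<open>Y\<close>
  depends only on \<open>p\<close> and \<open>f\<close>.\<close>

lemma ex_finite_test_set:
  fixes f :: "'a::{factorial_semiring, idom} fract poly"
  assumes p: "prime_elem p" and f: "f \<noteq> 0"
  shows "\<exists>Y. finite Y \<and> (\<forall>u k. u \<in> int_valued \<longrightarrow> u dvd f ^ k \<longrightarrow>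
    (\<forall>y\<in>Y. p dvd value_at u y) \<longrightarrow> (\<forall>x. p dvd value_at u x))"
proof -
  obtain d A where dA: "d dvd 1" "\<forall>h\<in>#A. prime_elem h" "f = d * prod_mset A"
    using field_poly_prime_decomposition[OF f] by blast
  have "\<forall>g :: 'a fract poly. \<exists>b h. b \<noteq> 0 \<and> smult (to_fract b) g = map_poly to_fract h"
    using clear_denominators by metis
  then obtain b F where bF: "\<And>g. b g \<noteq> 0"
    "\<And>g :: 'a fract poly. smult (to_fract (b g)) g = map_poly to_fract (F g)"
    by metis
  have F: "to_fract (b g) * poly g (to_fract x) = to_fract (poly (F g) x)" for g x
    by (metis bF(2) poly_map_to_fract poly_smult)
  obtain Y where Y: "finite Y"
    "\<And>x. \<exists>y\<in>Y. \<forall>g\<in>set_mset A. val p (poly (F g) y) \<le> val p (poly (F g) x)"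
    using dickson_enat[of "set_mset A" UNIV "\<lambda>g x. val p (poly (F g) x)"] by auto
  have "p dvd value_at u x"
    if u: "u \<in> int_valued" "u dvd f ^ k" and uY: "\<forall>y\<in>Y. p dvd value_at u y" for u k x
  proof -
    have "\<exists>A'. set_mset A' \<subseteq> set_mset A \<and> f ^ k = d ^ k * prod_mset A'"
    proof (induction k)
      case 0
      show ?case by (rule exI[of _ "{#}"]) simp
    next
      case (Suc k)
      then obtain A' where "set_mset A' \<subseteq> set_mset A" "f ^ k = d ^ k * prod_mset A'" by blast
      then show ?case by (intro exI[of _ "A + A'"]) (simp add: dA(3) mult_ac)
    qed
    then obtain A' where A': "set_mset A' \<subseteq> set_mset A" "f ^ k = d ^ k * prod_mset A'" by blast
    obtain u' where u': "f ^ k = u * u'" using u by blast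
    have "d ^ k dvd 1" using dA(1) by (metis dvd_power_same power_one)
    then obtain c B where cB: "c dvd 1" "set_mset B \<subseteq> set_mset A'" "u = c * prod_mset B"
      using dvd_prod_mset_primes[of u u' "d ^ k" A'] A' u' dA(2) by auto
    have BA: "set_mset B \<subseteq> set_mset A" using cB(2) A'(1) by blast
    obtain c0 where c0: "c = [:c0:]" using cB(1) by (auto simp: is_unit_poly_iff)
    obtain r s where rs: "c0 = to_fract r / to_fract s" "s \<noteq> 0"
      by (cases c0) (auto simp: Fract_conv_to_fract)
    \<comment> \<open>\<open>\<beta>\<close> clears the denominator of the constant
      \<open>c0\<close> and those of all factors in \<open>B\<close>, counted with
      multiplicity.\<close>
    define \<beta> where "\<beta> = s * (\<Prod>g\<in>#B. b g)"
    have "to_fract (\<Prod>g\<in>#B. b g) * poly (prod_mset B) (to_fract x)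
        = to_fract (\<Prod>g\<in>#B. poly (F g) x)" for x
      by (induction B) (auto simp: mult_ac F[symmetric])
    then have "to_fract (\<beta> * value_at u x) = to_fract (r * (\<Prod>g\<in>#B. poly (F g) x))" for x
      using u(1) rs by (simp add: value_at_eq \<beta>_def cB(3) c0 mult_ac)
    then have eq: "\<beta> * value_at u x = r * (\<Prod>g\<in>#B. poly (F g) x)" for x
      by (simp only: to_fract_eq_iff)
    have \<beta>: "\<beta> \<noteq> 0" using rs(2) bF(1) by (auto simp: \<beta>_def prod_mset_zero_iff)
    obtain y where y: "y \<in> Y" "\<forall>g\<in>set_mset A. val p (poly (F g) y) \<le> val p (poly (F g) x)"
      using Y(2) by blast
    \<comment> \<open>The factor \<open>r\<close> does not depend on the point, and the other
      factors are compared one by one.\<close>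
    have "val p (\<beta> * value_at u y) \<le> val p (\<beta> * value_at u x)"
      unfolding eq val_mult[OF p] using y BA
      by (intro add_mono order.refl val_prod_mset_mono p) auto
    \<comment> \<open>As \<open>\<beta>\<close> is nonzero, its valuation is finite and can be
      cancelled in \<open>enat\<close>, even if \<open>u\<close> vanishes at one of the
      points.\<close>
    then have "val p (value_at u y) \<le> val p (value_at u x)"
      using \<beta> by (simp add: val_mult[OF p]) (simp add: val_def)
    moreover have "enat 1 \<le> val p (value_at u y)"
      using uY y(1) power_dvd_iff_le_val[OF p, of 1] by simp
    ultimately show ?thesis using power_dvd_iff_le_val[OF p, of 1] by (metis order.trans power_one_right)
  qed
  with Y(1) show ?thesis by blast
qed

subsection \<open>Fixed divisors and compatible sets\<close>

text \<open>A point where \<open>g\<close> does not vanish makes the infimum finite, so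
  \<open>the_enat\<close> in \<open>min_val\<close> returns the true minimum.\<close>

lemma le_min_val_iff:
  fixes g :: "'a::{factorial_semiring, idom} fract poly"
  assumes q: "prime_elem q" and g: "g \<in> int_valued" "g \<noteq> 0"
  shows "n \<le> min_val q g \<longleftrightarrow> (\<forall>c. q ^ n dvd value_at g c)"
proof -
  obtain x where "value_at g x \<noteq> 0" using ex_nonroot[OF q g] by blast
  then have "(INF c. val q (value_at g c)) \<le> enat (multiplicity q (value_at g x))"
    by (intro INF_lower2[of x]) (auto simp: val_def)
  then obtain m where m: "(INF c. val q (value_at g c)) = enat m"
    by (cases "INF c. val q (value_at g c)") auto
  have "n \<le> min_val q g \<longleftrightarrow> enat n \<le> (INF c. val q (value_at g c))"
    by (simp add: min_val_def m)
  also have "\<dots> \<longleftrightarrow> (\<forall>c. q ^ n dvd value_at g c)"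
    by (simp add: le_INF_iff power_dvd_iff_le_val[OF q])
  finally show ?thesis .
qed

lemma prime_rep:
  "system_of_reps H {q. prime_elem q} \<Q> \<Longrightarrow> q \<in> \<Q> \<Longrightarrow> prime_elem q"
  unfolding system_of_reps_def by blast

lemma prime_rep_unique:
  fixes \<Q> :: "'a::{factorial_semiring, idom} set"
  assumes "system_of_reps (UNIV - {0}) {q. prime_elem q} \<Q>"
    and "q \<in> \<Q>" "q' \<in> \<Q>" "q dvd q'"
  shows "q = q'"
proof -
  have pr: "prime_elem q" "prime_elem q'" using prime_rep[OF assms(1)] assms(2,3) by blast+
  obtain u where u: "q' = q * u" using assms(4) by blast
  have "\<not> q' dvd 1" "irreducible q'" using pr prime_elem_imp_irreducible by auto
  with u pr have "u dvd 1" by (metis irreducibleD prime_elem_not_unit)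
  then obtain v where v: "1 = u * v" by blast
  then have "associated_in (UNIV - {0}) q q'"
    unfolding associated_in_def units_of_def u
    using v by (intro bexI[of _ u] CollectI conjI bexI[of _ v]) auto
  moreover have "associated_in (UNIV - {0}) q q"
    unfolding associated_in_def units_of_def
    by (intro bexI[of _ 1] CollectI conjI bexI[of _ "1::'a"]) auto
  ultimately show ?thesis
    using assms pr unfolding system_of_reps_def by blast
qed

text \<open>All these \<open>q\<close> divide one and the same nonzero value \<open>g x\<close>,
  which has finitely many prime factors up to normalization. Distinct representatives have distinct
  normalizations.\<close>

lemma finite_min_val:
  fixes \<Q> :: "'a::{factorial_semiring, idom} set"
  assumes \<Q>: "system_of_reps (UNIV - {0}) {q. prime_elem q} \<Q>"
    and g: "g \<in> int_valued" "g \<noteq> 0"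
  shows "finite {q \<in> \<Q>. min_val q g \<noteq> 0}"
proof (cases "\<Q> = {}")
  case False
  have pr: "prime_elem q" if "q \<in> \<Q>" for q
    using prime_rep[OF \<Q> that] .
  obtain x where x: "value_at g x \<noteq> 0" using False pr ex_nonroot[OF _ g] by blast
  have "normalize q \<in> prime_factors (value_at g x)" if "q \<in> {q \<in> \<Q>. min_val q g \<noteq> 0}" for q
  proof -
    have "1 \<le> min_val q g" using that by auto
    then have "q dvd value_at g x" using that pr g le_min_val_iff[of q g 1] by simp
    then show ?thesis using x that pr by (auto simp: prime_factors_dvd)
  qed
  then have "finite (normalize ` {q \<in> \<Q>. min_val q g \<noteq> 0})"
    by (intro finite_subset[OF _ finite_set_mset[of "prime_factorization (value_at g x)"]]) blast
  moreover have "inj_on normalize {q \<in> \<Q>. min_val q g \<noteq> 0}"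
    by (rule inj_onI) (auto intro: prime_rep_unique[OF \<Q>] dest: associatedD1)
  ultimately show ?thesis by (rule finite_imageD)
qed simp

lemma multiplicity_fixed_div:
  fixes \<Q> :: "'a::{factorial_semiring, idom} set"
  assumes \<Q>: "system_of_reps (UNIV - {0}) {q. prime_elem q} \<Q>"
    and g: "g \<in> int_valued" "g \<noteq> 0" and q: "q \<in> \<Q>"
  shows "multiplicity q (fixed_div \<Q> g) = min_val q g"
proof -
  let ?T = "{q \<in> \<Q>. min_val q g \<noteq> 0}"
  have pr: "prime_elem q" if "q \<in> \<Q>" for q
    using prime_rep[OF \<Q> that] .
  then have nz: "0 \<notin> \<Q>" using not_prime_elem_zero by blast
  have "multiplicity q (fixed_div \<Q> g) = (\<Sum>r\<in>?T. multiplicity q (r ^ min_val r g))"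
    unfolding fixed_div_def using finite_min_val[OF \<Q> g] nz pr[OF q]
    by (intro prime_elem_multiplicity_prod_distrib) auto
  \<comment> \<open>By uniqueness of representatives \<open>q\<close> does not divide any other
    \<open>r\<close>, so only the factor at \<open>r = q\<close> can contribute.\<close>
  also have "\<dots> = (\<Sum>r\<in>?T. if r = q then min_val q g else 0)"
  proof (intro sum.cong refl)
    fix r assume "r \<in> ?T"
    then show "multiplicity q (r ^ min_val r g) = (if r = q then min_val q g else 0)"
      using pr[OF q] nz prime_rep_unique[OF \<Q> q, of r]
      by (auto simp: prime_elem_multiplicity_power_distrib not_dvd_imp_multiplicity_0
          intro!: not_dvd_imp_multiplicity_0 dest: prime_elem_dvd_power)
  qed
  also have "\<dots> = min_val q g" using finite_min_val[OF \<Q> g] q by (simp add: sum.delta)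
  finally show ?thesis .
qed

lemma fixed_div_nonzero:
  fixes \<Q> :: "'a::{factorial_semiring, idom} set"
  assumes \<Q>: "system_of_reps (UNIV - {0}) {q. prime_elem q} \<Q>"
    and g: "g \<in> int_valued" "g \<noteq> 0"
  shows "fixed_div \<Q> g \<noteq> 0"
  using finite_min_val[OF \<Q> g] prime_rep[OF \<Q>] unfolding fixed_div_def
  by (metis (mono_tags, lifting) mem_Collect_eq power_not_zero prime_elem_not_zeroI prod_zero_iff)

lemma fixed_div_dvd_mult:
  fixes \<Q> :: "'a::{factorial_semiring, idom} set"
  assumes \<Q>: "system_of_reps (UNIV - {0}) {q. prime_elem q} \<Q>"
    and u: "u \<in> int_valued" "u \<noteq> 0" and w: "w \<in> int_valued" "w \<noteq> 0"
  shows "fixed_div \<Q> w dvd fixed_div \<Q> (u * w)"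
proof -
  have uw: "u * w \<in> int_valued" "u * w \<noteq> 0" using u w int_valued_mult by auto
  have le: "min_val q w \<le> min_val q (u * w)" if "q \<in> \<Q>" for q
  proof -
    have "prime_elem q" using prime_rep[OF \<Q> that] .
    then show ?thesis
      using le_min_val_iff[of q w "min_val q w"] le_min_val_iff[of q "u * w" "min_val q w"] u w uw
      by (simp add: value_at_mult)
  qed
  \<comment> \<open>The intermediate product has the index set of \<open>w\<close> and the exponents
    of \<open>u * w\<close>; first the exponents grow, then the index set.\<close>
  have "fixed_div \<Q> w dvd (\<Prod>q\<in>{q \<in> \<Q>. min_val q w \<noteq> 0}. q ^ min_val q (u * w))"
    unfolding fixed_div_def using le by (intro prod_dvd_prod le_imp_power_dvd) auto
  also have "\<dots> dvd fixed_div \<Q> (u * w)"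
    unfolding fixed_div_def using le finite_min_val[OF \<Q> uw]
    by (intro prod_dvd_prod_subset) fastforce+
  finally show ?thesis .
qed

text \<open>For \<open>g\<close> in \<open>div_closed f\<close> and \<open>p\<close> nonzero with
  \<open>const p\<close> in \<open>div_closed f\<close>, this is divisibility of \<open>g\<close> by
  \<open>const p\<close> in that monoid. It refers neither to \<open>\<Q>\<close> nor to minima of
  valuations.\<close>

definition fixed_dvd :: "'a::{factorial_semiring, idom} \<Rightarrow> 'a fract poly \<Rightarrow> bool" where
  "fixed_dvd p g \<longleftrightarrow> (\<forall>x. p dvd value_at g x)"

text \<open>The division is exact, and the multiplicity of \<open>q\<close> in the quotient is the
  difference of the two minima.\<close>

lemma dvd_fixed_div_quotient_iff:
  fixes \<Q> :: "'a::{factorial_semiring, idom} set"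
  assumes \<Q>: "system_of_reps (UNIV - {0}) {q. prime_elem q} \<Q>"
    and u: "u \<in> int_valued" "u \<noteq> 0" and w: "w \<in> int_valued" "w \<noteq> 0"
    and q: "q \<in> \<Q>"
  shows "q dvd fixed_div \<Q> (u * w) div fixed_div \<Q> w \<longleftrightarrow> min_val q w < min_val q (u * w)"
proof -
  have uw: "u * w \<in> int_valued" "u * w \<noteq> 0" using u w int_valued_mult by auto
  have pr: "prime_elem q" using prime_rep[OF \<Q>] q by blast
  obtain r where r: "fixed_div \<Q> (u * w) = fixed_div \<Q> w * r"
    using fixed_div_dvd_mult[OF \<Q> u w] by blast
  have nz: "fixed_div \<Q> w \<noteq> 0" "r \<noteq> 0"
    using fixed_div_nonzero[OF \<Q>] w uw r by (metis, metis mult_zero_right)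
  have "min_val q (u * w) = min_val q w + multiplicity q r"
    using multiplicity_fixed_div[OF \<Q> _ _ q] uw w r nz pr
    by (metis prime_elem_multiplicity_mult_distrib)
  moreover have "q dvd r \<longleftrightarrow> multiplicity q r \<noteq> 0"
    using nz pr by (simp add: prime_elem_multiplicity_eq_zero_iff)
  ultimately show ?thesis using r nz by simp
qed

section \<open>The divisor-closed submonoid generated by \<open>f\<close>\<close>

lemma div_closedD:
  assumes "g \<in> div_closed f"
  shows "g \<in> int_valued" "g \<noteq> 0" "\<exists>k. g dvd f ^ k"
  using assms by (auto simp: div_closed_def divides_in_def) (metis dvd_triv_left)

lemma div_closed_1: "1 \<in> div_closed f"
  by (auto simp: div_closed_def divides_in_def int_valued_1 intro!: exI[of _ 0] bexI[of _ 1])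

lemma div_closed_mult:
  assumes "g \<in> div_closed f" "h \<in> div_closed f"
  shows "g * h \<in> div_closed f"
proof -
  obtain k g' where "g' \<in> int_valued" "f ^ k = g * g'"
    using assms(1) by (auto simp: div_closed_def divides_in_def)
  moreover obtain l h' where "h' \<in> int_valued" "f ^ l = h * h'"
    using assms(2) by (auto simp: div_closed_def divides_in_def)
  ultimately have "g' * h' \<in> int_valued" "f ^ (k + l) = (g * h) * (g' * h')"
    by (auto simp: int_valued_mult power_add)
  then show ?thesis using assms
    by (auto simp: div_closed_def divides_in_def int_valued_mult)
qed

lemma div_closed_divisor:
  assumes "g * h \<in> div_closed f" "g \<in> int_valued" "h \<in> int_valued"
  shows "g \<in> div_closed f"
proof -
  obtain k z where "z \<in> int_valued" "f ^ k = (g * h) * z"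
    using assms(1) by (auto simp: div_closed_def divides_in_def)
  then have "h * z \<in> int_valued" "f ^ k = g * (h * z)"
    using assms by (auto simp: int_valued_mult mult.assoc)
  then show ?thesis using assms div_closedD(2)[OF assms(1)]
    by (auto simp: div_closed_def divides_in_def)
qed

text \<open>Since \<open>c\<close> divides all values of \<open>w\<close>, the quotient
  \<open>w / c\<close> is again integer-valued; as a divisor of \<open>w\<close> it stays in
  \<open>div_closed f\<close>.\<close>

lemma fixed_power_dvd_imp_factor:
  assumes w: "w \<in> div_closed f" and c: "c \<noteq> 0" "\<forall>x. c dvd value_at w x"
  obtains w' where "w' \<in> div_closed f" "w = const c * w'"
proof -
  define w' where "w' = smult (1 / to_fract c) w"
  have eq: "w = const c * w'" using c by (simp add: w'_def)
  have "poly w' (to_fract x) \<in> range to_fract" for x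
  proof -
    obtain r where "value_at w x = c * r" using c by blast
    then have "poly w' (to_fract x) = to_fract r"
      using c div_closedD(1)[OF w] by (simp add: w'_def flip: value_at_eq)
    then show ?thesis by blast
  qed
  then have "w' \<in> int_valued" by (simp add: int_valued_def)
  then have "w' \<in> div_closed f"
    using div_closed_divisor[of w' "const c" f] w eq by (simp add: mult.commute int_valued_const)
  with eq that show thesis by blast
qed

text \<open>From a witness \<open>w\<close> of compatibility, the highest power of the prime
  dividing all values is split off. The cofactor \<open>v\<close> is no longer divisible by
  \<open>p\<close>, but each \<open>u * v\<close> still is, because the minimum for
  \<open>u * w\<close> exceeds that for \<open>w\<close>. Conversely, the minimum is
  \<open>0\<close> for \<open>w\<close> and positive for each \<open>u * w\<close>.\<close>

lemma compatible_iff: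
  fixes \<Q> :: "'a::{factorial_semiring, idom} set"
  assumes \<Q>: "system_of_reps (UNIV - {0}) {q. prime_elem q} \<Q>"
    and p: "prime_elem p" and A: "A \<subseteq> div_closed f"
  shows "compatible \<Q> f p A \<longleftrightarrow>
    (\<exists>w\<in>div_closed f. \<not> fixed_dvd p w \<and> (\<forall>u\<in>A. fixed_dvd p (u * w)))"
proof -
  \<comment> \<open>\<open>p\<close> itself need not belong to \<open>\<Q>\<close>; its
    representative \<open>q\<close> has the same multiples.\<close>
  obtain q where q: "q \<in> \<Q>" "associated_in (UNIV - {0}) p q"
    using \<Q> p unfolding system_of_reps_def by blast
  then obtain e e' where e: "q = p * e" "e * e' = 1"
    by (auto simp: associated_in_def units_of_def)
  have pe: "p = q * e'" using e by (simp add: mult.assoc)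
  have dvd_eq: "p dvd z \<longleftrightarrow> q dvd z" for z
    using dvd_trans[of p q z] dvd_trans[of q p z] e(1) pe by (metis dvd_triv_left)
  have pr: "prime_elem q" using prime_rep[OF \<Q>] q by blast
  have *: "p dvd fixed_div \<Q> (u * w) div fixed_div \<Q> w \<longleftrightarrow> min_val q w < min_val q (u * w)"
    if "u \<in> div_closed f" "w \<in> div_closed f" for u w
    unfolding dvd_eq using that div_closedD q(1)
    by (intro dvd_fixed_div_quotient_iff[OF \<Q>]) blast+
  have fd: "fixed_dvd p g \<longleftrightarrow> 0 < min_val q g" if "g \<in> div_closed f" for g
    using le_min_val_iff[OF pr div_closedD(1,2)[OF that], of 1] by (simp add: fixed_dvd_def dvd_eq Suc_le_eq)
  show ?thesis
  proof
    assume "compatible \<Q> f p A"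
    then obtain w where w: "w \<in> div_closed f" "\<And>u. u \<in> A \<Longrightarrow> min_val q w < min_val q (u * w)"
      unfolding compatible_def using * A by blast
    define n where "n = min_val q w"
    note w' = div_closedD(1,2)[OF w(1)]
    have "\<forall>x. q ^ n dvd value_at w x" using le_min_val_iff[OF pr w', of n] by (simp add: n_def)
    then obtain v where v: "v \<in> div_closed f" "w = const (q ^ n) * v"
      using fixed_power_dvd_imp_factor[OF w(1), of "q ^ n"] pr by auto
    note v' = div_closedD(1,2)[OF v(1)]
    have vx: "value_at w x = q ^ n * value_at v x" for x
      unfolding v(2) by (subst value_at_mult) (auto simp: int_valued_const v' simp del: to_fract_mult)
    have "\<not> fixed_dvd p v"
    proof
      assume "fixed_dvd p v"
      then have "Suc n \<le> n"
        using le_min_val_iff[OF pr w', of "Suc n"]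
        by (auto simp: n_def[symmetric] vx fixed_dvd_def dvd_eq mult.commute intro: mult_dvd_mono)
      then show False by simp
    qed
    moreover have "fixed_dvd p (u * v)" if u: "u \<in> A" for u
    proof -
      have u': "u \<in> div_closed f" using u A by blast
      note uw = div_closedD(1,2)[OF div_closed_mult[OF u' w(1)]]
      have "Suc n \<le> min_val q (u * w)" using w(2)[OF u] by (simp add: n_def)
      then have "q dvd value_at u x * value_at v x" for x
        using pr div_closedD(1)[OF u'] w'
        by (auto simp: le_min_val_iff[OF pr uw] value_at_mult vx mult.left_commute)
      then show ?thesis using div_closedD(1)[OF u'] v'
        by (simp add: fixed_dvd_def dvd_eq value_at_mult)
    qed
    ultimately show "\<exists>w\<in>div_closed f. \<not> fixed_dvd p w \<and> (\<forall>u\<in>A. fixed_dvd p (u * w))"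
      using v(1) by blast
  next
    assume "\<exists>w\<in>div_closed f. \<not> fixed_dvd p w \<and> (\<forall>u\<in>A. fixed_dvd p (u * w))"
    then obtain w where "w \<in> div_closed f" "\<not> fixed_dvd p w" "\<forall>u\<in>A. fixed_dvd p (u * w)" by blast
    then have "\<forall>u\<in>A. min_val q w < min_val q (u * w)"
      using fd div_closed_mult A by (metis gr0I subsetD)
    with \<open>w \<in> div_closed f\<close> show "compatible \<Q> f p A"
      unfolding compatible_def using * A by blast
  qed
qed

section \<open>Units and constant atoms\<close>

text \<open>An invertible element is a unit of the polynomial ring, hence constant; its value at
  \<open>0\<close> and that of its inverse lie in the domain and have product
  \<open>1\<close>.\<close>

lemma units_of_div_closed_iff:
  "u \<in> units_of (div_closed f) \<longleftrightarrow> (\<exists>e. e dvd 1 \<and> u = const e)"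
proof
  assume "u \<in> units_of (div_closed f)"
  then obtain v where uv: "u \<in> int_valued" "v \<in> int_valued" "u * v = 1"
    unfolding units_of_def using div_closedD(1) by blast
  then have "u dvd 1" by (metis dvd_triv_left)
  then obtain c where c: "u = [:c:]" by (auto simp: is_unit_poly_iff)
  have "c = to_fract (value_at u 0)" using uv(1) by (simp add: value_at_eq c)
  moreover have "value_at u 0 * value_at v 0 = 1"
    using uv by (metis value_at_1 value_at_mult)
  then have "value_at u 0 dvd 1" by (metis dvd_triv_left)
  ultimately show "\<exists>e. e dvd 1 \<and> u = const e" using c by blast
next
  assume "\<exists>e. e dvd 1 \<and> u = const e"
  then obtain e e' where e: "1 = e * e'" "u = const e" by blast
  have 1: "const e * const e' = 1" "const e' * const e = 1"
    using e(1) by (simp_all add: one_pCons mult.commute flip: to_fract_mult)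
  then have "const e \<in> div_closed f" "const e' \<in> div_closed f"
    using div_closed_divisor[of "const e" "const e'" f] div_closed_divisor[of "const e'" "const e" f]
      div_closed_1[of f] int_valued_const by metis+
  with 1 e(2) show "u \<in> units_of (div_closed f)" unfolding units_of_def by blast
qed

text \<open>Both factors of a factorization of \<open>p\<close> in the domain give constants in
  \<open>div_closed f\<close>, as this monoid is closed under divisors. So \<open>p\<close> is
  irreducible, hence prime by factoriality.\<close>

lemma prime_elem_if_const_atom:
  fixes p :: "'a::{factorial_semiring, idom}"
  assumes p: "const p \<in> atoms_of (div_closed f)"
  shows "prime_elem p"
proof (intro irreducible_imp_prime_elem irreducibleI)
  have pH: "const p \<in> div_closed f" using p by (simp add: atoms_of_def)
  show "p \<noteq> 0" using div_closedD(2)[OF pH] by auto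
  show "\<not> p dvd 1" using p by (auto simp: atoms_of_def units_of_div_closed_iff)
  fix a b assume ab: "p = a * b"
  then have eq: "const p = const a * const b" "const p = const b * const a"
    by (simp_all add: mult.commute)
  then have "const a \<in> div_closed f" "const b \<in> div_closed f"
    using pH div_closed_divisor int_valued_const by metis+
  with eq(1) p have "const a \<in> units_of (div_closed f) \<or> const b \<in> units_of (div_closed f)"
    unfolding atoms_of_def by blast
  then show "a dvd 1 \<or> b dvd 1" by (auto simp: units_of_div_closed_iff)
qed

subsection \<open>Prime ideals and divisorial closure\<close>

lemma prime_s_idealI:
  assumes "1 \<in> H" "\<And>x y. x \<in> H \<Longrightarrow> y \<in> H \<Longrightarrow> x * y \<in> H" "P \<subseteq> H" "1 \<notin> P"
    and "\<And>x h. x \<in> P \<Longrightarrow> h \<in> H \<Longrightarrow> x * h \<in> P"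
    and "\<And>x y. x \<in> H \<Longrightarrow> y \<in> H \<Longrightarrow> x * y \<in> P \<Longrightarrow> x \<in> P \<or> y \<in> P"
  shows "prime_s_ideal H P"
proof -
  have "P * H = P"
  proof
    show "P * H \<subseteq> P" using assms(5) by (auto simp: set_times_def)
    show "P \<subseteq> P * H" using assms(1) set_times_intro[of _ P 1 H] by auto
  qed
  then show ?thesis using assms unfolding prime_s_ideal_def s_ideal_def by blast
qed

lemma prime_s_idealD:
  assumes "prime_s_ideal H P"
  shows "P \<subseteq> H" "1 \<in> H - P" "x \<in> P \<Longrightarrow> h \<in> H \<Longrightarrow> x * h \<in> P"
    "x \<in> H \<Longrightarrow> y \<in> H \<Longrightarrow> x * y \<in> P \<Longrightarrow> x \<in> P \<or> y \<in> P"
    "x \<in> H - P \<Longrightarrow> y \<in> H - P \<Longrightarrow> x * y \<in> H - P"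
  using assms set_times_intro[of x P h H] unfolding prime_s_ideal_def s_ideal_def by auto

lemma set_times_subset_prime_s_ideal:
  "prime_s_ideal H P \<Longrightarrow> B \<subseteq> P \<Longrightarrow> B * H \<subseteq> P"
  using prime_s_idealD(3)[of H P] unfolding set_times_def by blast

lemma prod_notin_prime_s_ideal:
  assumes "prime_s_ideal H P" "finite I" "\<And>i. i \<in> I \<Longrightarrow> c i \<in> H - P"
  shows "prod c I \<in> H - P"
  using assms(2,3)
  by (induction I) (use prime_s_idealD(2,5)[OF assms(1)] in auto)

text \<open>As \<open>1\<close> lies in the inverse of \<open>Y\<close>, the closure is contained in
  \<open>H\<close>. It is all of \<open>H\<close> iff it contains \<open>1\<close>, that is, iff the
  inverse of \<open>Y\<close> is contained in \<open>H\<close>.\<close>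

lemma v_closure_psubset_iff:
  assumes H: "1 \<in> H" "\<And>x y. x \<in> H \<Longrightarrow> y \<in> H \<Longrightarrow> x * y \<in> H" and Y: "Y \<subseteq> H"
  shows "v_closure H (to_fract ` Y) \<subset> to_fract ` H \<longleftrightarrow>
    \<not> monoid_inverse H (to_fract ` Y) \<subseteq> to_fract ` H"
proof -
  let ?I = "monoid_inverse H (to_fract ` Y)"
  have L: "to_fract x \<in> quotient_group H" if "x \<in> H" for x
    using that H(1) unfolding quotient_group_def by (intro CollectI exI[of _ x] exI[of _ 1]) simp
  have 1: "1 \<in> to_fract ` H" using H(1) by (metis image_eqI to_fract_1)
  have "1 \<in> ?I"
    using L[OF H(1)] Y by (auto simp: monoid_inverse_def elt_set_times_def)
  then have sub: "v_closure H (to_fract ` Y) \<subseteq> to_fract ` H"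
    unfolding v_closure_def monoid_inverse_def[of H ?I] by (force simp: elt_set_times_def)
  show ?thesis
  proof (cases "?I \<subseteq> to_fract ` H")
    case True
    have "to_fract h * z \<in> to_fract ` H" if hz: "h \<in> H" "z \<in> ?I" for h z
    proof -
      obtain z' where "z' \<in> H" "z = to_fract z'" using True hz(2) by blast
      then show ?thesis using H(2)[OF hz(1)] by (metis image_eqI to_fract_mult)
    qed
    then have "to_fract h \<in> v_closure H (to_fract ` Y)" if "h \<in> H" for h
      unfolding v_closure_def monoid_inverse_def[of H ?I] using that L
      by (auto simp: elt_set_times_def)
    with True show ?thesis by blast
  next
    case False
    then have "1 \<notin> v_closure H (to_fract ` Y)"
      unfolding v_closure_def monoid_inverse_def[of H ?I] by (auto simp: elt_set_times_def)
    with 1 show ?thesis using sub False by blast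
  qed
qed

lemma fixed_dvd_mult_right:
  "g \<in> int_valued \<Longrightarrow> h \<in> int_valued \<Longrightarrow> fixed_dvd p g \<Longrightarrow> fixed_dvd p (g * h)"
  by (simp add: fixed_dvd_def value_at_mult)

subsection \<open>Conductors\<close>

definition conductor ::
  "'a::{factorial_semiring, idom} fract poly \<Rightarrow> 'a \<Rightarrow> 'a fract poly \<Rightarrow> 'a fract poly set" where
  "conductor f p w = {u \<in> div_closed f. fixed_dvd p (u * w)}"

text \<open>Primality of \<open>p\<close> in the domain is the form in which the atom property is
  used; \<open>prime_elem_if_const_atom\<close> provides it.\<close>

locale constant_prime =
  fixes f :: "'a::{factorial_semiring, idom} fract poly" and p :: 'a
  assumes f: "f \<in> int_valued - {0}" and p_mem: "const p \<in> div_closed f" and prime_p: "prime_elem p"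
begin

abbreviation H where "H \<equiv> div_closed f"

lemma p_neq_0: "p \<noteq> 0"
  using prime_p by auto

lemmas memD = div_closedD(1,2)[of _ f]

lemma fixed_dvd_const_mult: "g \<in> H \<Longrightarrow> fixed_dvd p (const p * g)"
  by (simp add: fixed_dvd_def value_at_mult int_valued_const memD del: mult_pCons_left)

lemma fixed_dvdE:
  assumes "w \<in> H" "fixed_dvd p w"
  obtains w' where "w' \<in> H" "w = const p * w'"
  using fixed_power_dvd_imp_factor[OF assms(1) p_neq_0] assms(2) by (auto simp: fixed_dvd_def)

lemma conductor_subset: "conductor f p w \<subseteq> H"
  by (auto simp: conductor_def)

lemma conductorE:
  assumes "u \<in> conductor f p w" "w \<in> H"
  obtains u' where "u' \<in> H" "u * w = const p * u'"
proof (rule fixed_dvdE[OF _ _ that])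
  show "u * w \<in> H" "fixed_dvd p (u * w)"
    using assms div_closed_mult by (auto simp: conductor_def)
qed

lemma p_in_conductor: "w \<in> H \<Longrightarrow> const p \<in> conductor f p w"
  using fixed_dvd_const_mult p_mem by (simp add: conductor_def)

lemma conductor_mono:
  assumes "w \<in> H" "v \<in> H"
  shows "conductor f p w \<subseteq> conductor f p (w * v)"
proof
  fix u assume u: "u \<in> conductor f p w"
  then have "u * w \<in> int_valued" using assms(1) memD by (auto simp: conductor_def intro!: int_valued_mult)
  then have "fixed_dvd p (u * w * v)"
    using u memD(1)[OF assms(2)] fixed_dvd_mult_right by (auto simp: conductor_def)
  with u show "u \<in> conductor f p (w * v)" by (simp add: conductor_def mult.assoc)
qed

text \<open>Since \<open>p\<close> is prime, \<open>(p : w)\<close> consists of the \<open>u\<close>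
  whose values are divisible by \<open>p\<close> at all test points where the value of
  \<open>w\<close> is not. It is thus determined by a subset of the finite test set.\<close>

lemma finite_conductors: "finite (conductor f p ` H)"
proof -
  obtain Y where Y: "finite Y"
    "\<And>u k x. u \<in> int_valued \<Longrightarrow> u dvd f ^ k \<Longrightarrow> \<forall>y\<in>Y. p dvd value_at u y \<Longrightarrow> p dvd value_at u x"
    using ex_finite_test_set[OF prime_p, of f] f by blast
  have fd: "fixed_dvd p u \<longleftrightarrow> (\<forall>y\<in>Y. p dvd value_at u y)" if "u \<in> H" for u
    using Y(2) div_closedD[OF that] unfolding fixed_dvd_def by blast
  let ?c = "\<lambda>Z. {u \<in> H. \<forall>y\<in>Z. p dvd value_at u y}"
  have "conductor f p w = ?c {y \<in> Y. \<not> p dvd value_at w y}" if w: "w \<in> H" for w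
  proof -
    have "fixed_dvd p (u * w) \<longleftrightarrow> (\<forall>y\<in>{y \<in> Y. \<not> p dvd value_at w y}. p dvd value_at u y)"
      if "u \<in> H" for u
      using that w by (auto simp: fd div_closed_mult value_at_mult memD prime_elem_dvd_mult_iff[OF prime_p])
    then show ?thesis by (auto simp: conductor_def)
  qed
  then have "conductor f p ` H \<subseteq> ?c ` Pow Y" by blast
  then show ?thesis using Y(1) finite_subset by blast
qed

text \<open>A maximal member among the proper conductors \<open>(p : w * v)\<close> is prime: if
  \<open>x\<close> lies outside it, then \<open>(p : w * v * x)\<close> is still proper and contains
  it, so the two are equal; and \<open>x * y \<in> (p : w * v)\<close> says that
  \<open>y \<in> (p : w * v * x)\<close>.\<close>

lemma ex_prime_conductor:
  assumes w: "w \<in> H" "\<not> fixed_dvd p w"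
  obtains v where "v \<in> H" "\<not> fixed_dvd p (w * v)" "prime_s_ideal H (conductor f p (w * v))"
proof -
  let ?V = "{v \<in> H. \<not> fixed_dvd p (w * v)}"
  let ?\<C> = "(\<lambda>v. conductor f p (w * v)) ` ?V"
  have "?\<C> \<subseteq> conductor f p ` H" using w(1) div_closed_mult by blast
  then have "finite ?\<C>" using finite_conductors finite_subset by blast
  moreover have "?\<C> \<noteq> {}" using w div_closed_1[of f] by (auto intro!: exI[of _ 1])
  ultimately have "\<exists>M\<in>?\<C>. \<forall>M'\<in>?\<C>. M \<subseteq> M' \<longrightarrow> M = M'"
    by (rule finite_has_maximal)
  then obtain M where M: "M \<in> ?\<C>" "\<forall>M'\<in>?\<C>. M \<subseteq> M' \<longrightarrow> M = M'" ..
  from M(1) obtain v where v: "v \<in> ?V" "M = conductor f p (w * v)" by blast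
  have max: "conductor f p (w * v) = conductor f p (w * v')"
    if "v' \<in> ?V" "conductor f p (w * v) \<subseteq> conductor f p (w * v')" for v'
    using M(2) that v(2) by simp
  have wv: "w * v \<in> H" using w v div_closed_mult by blast
  have "prime_s_ideal H (conductor f p (w * v))"
  proof (rule prime_s_idealI)
    show "1 \<notin> conductor f p (w * v)" using v by (simp add: conductor_def)
    show "x * h \<in> conductor f p (w * v)" if "x \<in> conductor f p (w * v)" "h \<in> H" for x h
    proof -
      have "x * (w * v) \<in> H" using that(1) wv div_closed_mult by (auto simp: conductor_def)
      then have "fixed_dvd p (x * (w * v) * h)"
        using that(1) memD(1) memD(1)[OF that(2)] fixed_dvd_mult_right unfolding conductor_def by blast
      then show ?thesis using that by (simp add: conductor_def div_closed_mult mult_ac)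
    qed
    show "x \<in> conductor f p (w * v) \<or> y \<in> conductor f p (w * v)"
      if xy: "x \<in> H" "y \<in> H" "x * y \<in> conductor f p (w * v)" for x y
    proof (rule disj_imp[THEN iffD2], rule impI)
      assume "x \<notin> conductor f p (w * v)"
      with xy v have "v * x \<in> ?V" by (simp add: conductor_def div_closed_mult mult_ac)
      moreover have "conductor f p (w * v) \<subseteq> conductor f p (w * (v * x))"
        using conductor_mono[OF wv xy(1)] by (simp add: mult.assoc)
      ultimately have "conductor f p (w * v) = conductor f p (w * (v * x))" by (rule max)
      moreover have "y \<in> conductor f p (w * (v * x))"
        using xy by (simp add: conductor_def mult_ac)
      ultimately show "y \<in> conductor f p (w * v)" by simp
    qed
  qed (simp_all add: div_closed_1 div_closed_mult conductor_subset)
  with v that show thesis by blast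
qed

section \<open>Prime conductors and the primes containing \<open>p\<close>\<close>

text \<open>Let \<open>P\<close> be a nonempty prime inside the conductor. It misses
  \<open>w\<close>, because \<open>p\<close> does not divide \<open>w * w\<close>. If
  \<open>p \<in> P\<close>, then every \<open>u\<close> in the conductor satisfies
  \<open>u * w \<in> P\<close>, hence \<open>u \<in> P\<close>. If \<open>p \<notin> P\<close>, some
  \<open>e \<in> P\<close> would have \<open>e * w ^ n\<close> divisible by \<open>p ^ n\<close> for
  all \<open>n\<close>, which fails at a suitable point.\<close>

lemma prime_conductor_min:
  assumes w: "w \<in> H" "\<not> fixed_dvd p w" and prime: "prime_s_ideal H (conductor f p w)"
  shows "conductor f p w \<in> min_primes H"
proof -
  have "P = conductor f p w"
    if P: "prime_s_ideal H P" "P \<noteq> {}" "P \<subseteq> conductor f p w" for P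
  proof -
    obtain x0 where x0: "\<not> p dvd value_at w x0" using w(2) by (auto simp: fixed_dvd_def)
    have "w \<notin> conductor f p w"
      using x0 w(1) prime_p by (auto simp: conductor_def fixed_dvd_def value_at_mult memD prime_elem_dvd_mult_iff)
    then have wP: "w \<notin> P" using P(3) by blast
    note P_D = prime_s_idealD[OF P(1)]
    have eq: "\<exists>u'\<in>H. u * w = const p * u'" if "u \<in> conductor f p w" for u
      using conductorE[OF that w(1)] by metis
    have "const p \<in> P"
    proof (rule ccontr)
      assume pP: "const p \<notin> P"
      obtain e where e: "e \<in> P" using P(2) by blast
      then have eH: "e \<in> H" using P_D(1) by blast
      \<comment> \<open>Keeping the cofactor \<open>e'\<close> in \<open>P\<close> drives the
        induction: \<open>p\<close> divides \<open>e' * w\<close>, and the quotient is again in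
        \<open>P\<close> because \<open>p\<close> is not.\<close>
      have "\<exists>e'\<in>P. e * w ^ n = const p ^ n * e'" for n
      proof (induction n)
        case 0
        show ?case using e by simp
      next
        case (Suc n)
        then obtain e' where e': "e' \<in> P" "e * w ^ n = const p ^ n * e'" by blast
        then obtain u where u: "u \<in> H" "e' * w = const p * u" using eq P(3) by blast
        have "const p * u \<in> P" using P_D(3)[OF e'(1) w(1)] u(2) by simp
        then have "u \<in> P" using P_D(4)[OF p_mem u(1)] pP by blast
        moreover have "e * w ^ Suc n = const p ^ Suc n * u"
        proof -
          have "e * w ^ Suc n = (e * w ^ n) * w" by (simp only: power_Suc2 mult.assoc)
          also have "\<dots> = const p ^ n * (e' * w)" by (simp only: e'(2) mult.assoc)
          also have "\<dots> = const p ^ Suc n * u" by (simp only: u(2) power_Suc2 mult.assoc)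
          finally show ?thesis .
        qed
        ultimately show ?case by blast
      qed
      note powers = this
      \<comment> \<open>At such a point the powers of \<open>w\<close> contribute nothing to the
        \<open>p\<close>-adic valuation, while \<open>e\<close> has a finite one, which would have
        to be at least every \<open>n\<close>.\<close>
      obtain x where x: "\<not> p dvd value_at w x" "value_at e x \<noteq> 0"
        using ex_not_dvd_nonroot[OF prime_p _ x0 memD[OF eH]] memD[OF w(1)] by blast
      have le: "n \<le> multiplicity p (value_at e x)" for n
      proof -
        obtain e' where e': "e' \<in> P" "e * w ^ n = const p ^ n * e'" using powers by blast
        then have "e' \<in> H" using P_D(1) by blast
        then have eq: "value_at e x * value_at w x ^ n = p ^ n * value_at e' x"
          using arg_cong[OF e'(2), of "\<lambda>g. value_at g x"] memD eH w(1)
          by (simp add: value_at_mult value_at_power int_valued_power int_valued_const)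
        have nz: "value_at w x ^ n \<noteq> 0" using x(1) by auto
        have "n \<le> multiplicity p (value_at e x * value_at w x ^ n)"
        proof (rule multiplicity_geI)
          show "value_at e x * value_at w x ^ n \<noteq> 0" using x(2) nz by simp
          show "p ^ n dvd value_at e x * value_at w x ^ n" by (simp add: eq)
        qed (use prime_p in auto)
        also have "\<dots> = multiplicity p (value_at e x) + multiplicity p (value_at w x ^ n)"
          using prime_p x(2) nz by (intro prime_elem_multiplicity_mult_distrib)
        also have "multiplicity p (value_at w x ^ n) = 0"
          using x(1) prime_elem_dvd_power[OF prime_p] by (intro not_dvd_imp_multiplicity_0) blast
        finally show ?thesis by simp
      qed
      have "Suc (multiplicity p (value_at e x)) \<le> multiplicity p (value_at e x)" by (rule le)
      then show False by simp
    qed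
    have "u \<in> P" if u: "u \<in> conductor f p w" for u
    proof -
      obtain u' where "u' \<in> H" "u * w = const p * u'" using eq[OF u] by blast
      then have "u * w \<in> P" using P_D(3)[OF \<open>const p \<in> P\<close>] by metis
      then show ?thesis using P_D(4) wP w(1) u conductor_subset by blast
    qed
    with P(3) show ?thesis by blast
  qed
  then show ?thesis using prime p_in_conductor[OF w(1)] unfolding min_primes_def by blast
qed

text \<open>Otherwise \<open>P\<close> misses an element of each of the finitely many prime conductors. The product
  \<open>u\<close> of these elements is not divisible by \<open>p\<close>, so some \<open>(p : u * v)\<close> is prime. It contains one of
  the factors of \<open>u\<close>, so \<open>p\<close> divides \<open>u\<^sup>2 * v\<close> and hence, value by value, \<open>u * v\<close>.\<close>

lemma ex_conductor_subset_prime: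
  assumes P: "prime_s_ideal H P" "const p \<in> P"
  obtains w where "w \<in> H" "\<not> fixed_dvd p w" "prime_s_ideal H (conductor f p w)" "conductor f p w \<subseteq> P"
proof (rule ccontr)
  assume "\<not> thesis"
  define \<M> where "\<M> = {M \<in> conductor f p ` {w \<in> H. \<not> fixed_dvd p w}. prime_s_ideal H M}"
  have fin: "finite \<M>" unfolding \<M>_def by (rule finite_subset[OF _ finite_conductors]) auto
  have "\<forall>M\<in>\<M>. \<exists>u. u \<in> M - P" using that \<open>\<not> thesis\<close> by (auto simp: \<M>_def)
  from bchoice[OF this] obtain c where c: "\<forall>M\<in>\<M>. c M \<in> M - P" ..
  have "M \<subseteq> H" if "M \<in> \<M>" for M using that conductor_subset by (auto simp: \<M>_def)
  with c have cH: "c M \<in> H - P" if "M \<in> \<M>" for M using that by blast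
  define u where "u = prod c \<M>"
  have u: "u \<in> H - P"
    unfolding u_def by (rule prod_notin_prime_s_ideal[OF P(1) fin]) (rule cH)
  have "\<not> fixed_dvd p u"
  proof
    assume "fixed_dvd p u"
    with u obtain u' where "u' \<in> H" "u = const p * u'" by (auto elim: fixed_dvdE)
    with u prime_s_idealD(3)[OF P] show False by simp
  qed
  then obtain v where v: "v \<in> H" "\<not> fixed_dvd p (u * v)" "prime_s_ideal H (conductor f p (u * v))"
    using ex_prime_conductor[of u] u by blast
  define M where "M = conductor f p (u * v)"
  have M: "M \<in> \<M>" using v u div_closed_mult unfolding \<M>_def M_def by blast
  then have "c M \<in> M" using c by blast
  then have cM: "c M \<in> H" "fixed_dvd p (c M * (u * v))" by (auto simp: M_def conductor_def)
  define r where "r = prod c (\<M> - {M})"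
  have r: "u = c M * r" unfolding u_def r_def by (rule prod.remove[OF fin M])
  have "r \<in> H - P"
    unfolding r_def using fin cH by (intro prod_notin_prime_s_ideal[OF P(1)]) auto
  then have rH: "r \<in> H" by blast
  have "p dvd value_at (u * v) x" for x
  proof -
    have uv: "value_at (u * v) x = value_at (c M) x * value_at r x * value_at v x"
      using rH cM(1) v(1) by (simp add: r value_at_mult memD int_valued_mult)
    have "p dvd value_at (c M) x * value_at (u * v) x"
      using cM v(1) u by (simp add: fixed_dvd_def value_at_mult memD int_valued_mult)
    then show ?thesis using prime_elem_dvd_mult_iff[OF prime_p] uv by auto
  qed
  with v(2) show False by (simp add: fixed_dvd_def)
qed

section \<open>Generation by atoms\<close>

text \<open>Descent along an additive measure that is positive on nonunits: as long as
  \<open>u\<close> is not an atom, it splits into two nonunits, one of which lies in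
  \<open>P\<close> and has smaller measure.\<close>

lemma prime_contains_atom:
  assumes P: "prime_s_ideal H P" and "u \<in> P"
  shows "\<exists>a\<in>atoms_of H \<inter> P. \<exists>h\<in>H. u = a * h"
proof -
  \<comment> \<open>A point where \<open>f\<close> does not vanish is a nonroot of every divisor of
    a power of \<open>f\<close>.\<close>
  obtain x0 where x0: "value_at f x0 \<noteq> 0" using ex_nonroot[OF prime_p] f by blast
  have nz: "value_at u x0 \<noteq> 0" if "u \<in> H" for u
  proof -
    obtain k z where "z \<in> int_valued" "f ^ k = u * z"
      using \<open>u \<in> H\<close> by (auto simp: div_closed_def divides_in_def)
    then have "value_at u x0 * value_at z x0 = value_at f x0 ^ k"
      using f memD[OF that] by (metis Diff_iff value_at_mult value_at_power)
    with x0 show ?thesis by auto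
  qed
  \<comment> \<open>The degree alone does not detect constant nonunits; the number of prime factors
    of the value at \<open>x0\<close> does.\<close>
  define \<mu> where "\<mu> = (\<lambda>u. degree u + size (prime_factorization (value_at u x0)))"
  have \<mu>_mult: "\<mu> (x * y) = \<mu> x + \<mu> y" if "x \<in> H" "y \<in> H" for x y
    using that nz memD by (simp add: \<mu>_def degree_mult_eq value_at_mult prime_factorization_mult)
  have \<mu>_pos: "0 < \<mu> y" if y: "y \<in> H" "y \<notin> units_of H" for y
  proof (rule ccontr)
    assume "\<not> 0 < \<mu> y"
    then have "degree y = 0" "prime_factorization (value_at y x0) = {#}" by (auto simp: \<mu>_def)
    then obtain c where c: "y = [:c:]" and unit: "value_at y x0 dvd 1"
      using nz[OF y(1)] by (auto elim: degree_eq_zeroE simp: prime_factorization_empty_iff)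
    have "c = to_fract (value_at y x0)" using value_at_eq[OF memD(1)[OF y(1)], of x0] by (simp add: c)
    with c unit y(2) show False by (auto simp: units_of_div_closed_iff)
  qed
  show ?thesis using \<open>u \<in> P\<close>
  proof (induction "\<mu> u" arbitrary: u rule: less_induct)
    case less
    note P_D = prime_s_idealD[OF P]
    have uH: "u \<in> H" using less.prems P_D(1) by blast
    have nu: "u \<notin> units_of H" using less.prems P_D(2,3) by (auto simp: units_of_def) metis
    show ?case
    proof (cases "u \<in> atoms_of H")
      case True
      with less.prems show ?thesis by (intro bexI[of _ u] bexI[of _ 1]) (auto simp: div_closed_1)
    next
      case False
      then obtain x y where xy: "x \<in> H" "y \<in> H" "u = x * y" "x \<notin> units_of H" "y \<notin> units_of H"
        using uH nu by (auto simp: atoms_of_def)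
      have step: ?thesis if "x \<in> P" "x \<in> H" "y \<in> H" "u = x * y" "y \<notin> units_of H" for x y
      proof -
        have "\<mu> x < \<mu> u" using that \<mu>_mult \<mu>_pos by simp
        then obtain a h where "a \<in> atoms_of H \<inter> P" "h \<in> H" "x = a * h"
          using less.hyps \<open>x \<in> P\<close> by blast
        then show ?thesis using that by (metis div_closed_mult mult.assoc)
      qed
      have "x \<in> P \<or> y \<in> P" using P_D(4) xy less.prems by blast
      then show ?thesis using step[of x y] step[of y x] xy by (auto simp: mult.commute)
    qed
  qed
qed

text \<open>Each element of the conductor is a multiple of an atom in it. A nonconstant atom can be
  replaced by its representative in \<open>\<S>\<close>; a constant one is a multiple of
  \<open>p\<close>, because \<open>p\<close> divides its product with a value of \<open>w\<close>
  that \<open>p\<close> does not divide.\<close>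

lemma prime_conductor_eq:
  assumes w: "w \<in> H" "\<not> fixed_dvd p w" and prime: "prime_s_ideal H (conductor f p w)"
    and \<S>: "system_of_reps H (atoms_of H - range const) \<S>"
  shows "conductor f p w = ((conductor f p w \<inter> \<S>) \<union> {const p}) * H"
proof
  let ?P = "conductor f p w"
  show "((?P \<inter> \<S>) \<union> {const p}) * H \<subseteq> ?P"
    using p_in_conductor[OF w(1)] by (intro set_times_subset_prime_s_ideal[OF prime]) blast
  show "?P \<subseteq> ((?P \<inter> \<S>) \<union> {const p}) * H"
  proof
    fix u assume "u \<in> ?P"
    then obtain a h where a: "a \<in> atoms_of H" "a \<in> ?P" "h \<in> H" "u = a * h"
      using prime_contains_atom[OF prime] by blast
    show "u \<in> ((?P \<inter> \<S>) \<union> {const p}) * H"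
    proof (cases "a \<in> range const")
      case True
      then obtain c where c: "a = const c" by blast
      obtain x where "\<not> p dvd value_at w x" using w(2) by (auto simp: fixed_dvd_def)
      moreover have "p dvd c * value_at w x"
        using a(2) w(1) unfolding c conductor_def fixed_dvd_def
        by (auto simp: value_at_mult int_valued_const memD simp del: mult_pCons_left)
      ultimately have "p dvd c" using prime_elem_dvd_mult_iff[OF prime_p] by blast
      then obtain e where e: "c = p * e" by blast
      then have ae: "a = const e * const p" by (simp add: c mult.commute)
      have "a \<in> H" using a(1) by (simp add: atoms_of_def)
      then have "const e \<in> H" using div_closed_divisor[of "const e" "const p" f] ae int_valued_const by metis
      then have "const e * h \<in> H" using a(3) div_closed_mult by blast
      moreover have "u = const p * (const e * h)" by (simp only: a(4) ae mult_ac)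
      ultimately show ?thesis using set_times_intro by blast
    next
      case False
      then obtain y where y: "y \<in> \<S>" "associated_in H a y"
        using \<S> a(1) unfolding system_of_reps_def by blast
      then obtain e e' where e: "e \<in> H" "e' \<in> H" "e * e' = 1" "y = a * e"
        by (auto simp: associated_in_def units_of_def)
      have "y \<in> ?P" using e prime_s_idealD(3)[OF prime a(2)] by blast
      moreover have "u = y * (e' * h)" using e by (metis a(4) mult.assoc mult.right_neutral)
      moreover have "e' * h \<in> H" using e a div_closed_mult by blast
      ultimately show ?thesis using y(1) set_times_intro by blast
    qed
  qed
qed

section \<open>Divisorial closure and conductors\<close>

text \<open>The elements \<open>z\<close> of the inverse of \<open>A \<union> {p}\<close> are the
  fractions \<open>w / p\<close> with \<open>w \<in> H\<close> and
  \<open>A \<subseteq> (p : w)\<close>. Such a fraction lies outside \<open>H\<close> iff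
  \<open>p\<close> does not divide \<open>w\<close>.\<close>

lemma v_closure_psubset_iff_conductor:
  assumes A: "A \<subseteq> H"
  shows "v_closure H (to_fract ` (A \<union> {const p})) \<subset> to_fract ` H \<longleftrightarrow>
    (\<exists>w\<in>H. \<not> fixed_dvd p w \<and> A \<subseteq> conductor f p w)"
proof -
  let ?I = "monoid_inverse H (to_fract ` (A \<union> {const p}))"
  have p0: "to_fract (const p) \<noteq> 0" using p_neq_0 by simp
  have "\<not> ?I \<subseteq> to_fract ` H \<longleftrightarrow> (\<exists>w\<in>H. \<not> fixed_dvd p w \<and> A \<subseteq> conductor f p w)"
  proof
    assume "\<not> ?I \<subseteq> to_fract ` H"
    then obtain z where z: "z \<in> ?I" "z \<notin> to_fract ` H" by blast
    have z_mult: "\<exists>v\<in>H. z * to_fract u = to_fract v" if "u \<in> A \<union> {const p}" for u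
      using z(1) that unfolding monoid_inverse_def elt_set_times_def by blast
    obtain w where w: "w \<in> H" "z * to_fract (const p) = to_fract w" using z_mult by blast
    have "\<not> fixed_dvd p w"
    proof
      assume "fixed_dvd p w"
      then obtain w' where "w' \<in> H" "w = const p * w'" using fixed_dvdE[OF w(1)] by blast
      then have "z * to_fract (const p) = to_fract w' * to_fract (const p)"
        using w(2) by (simp only: to_fract_mult mult.commute)
      then have "z = to_fract w'" using p0 mult_right_cancel by blast
      with z(2) \<open>w' \<in> H\<close> show False by blast
    qed
    moreover have "u \<in> conductor f p w" if u: "u \<in> A" for u
    proof -
      obtain v where v: "v \<in> H" "z * to_fract u = to_fract v" using z_mult u by blast
      have "to_fract (u * w) = (z * to_fract u) * to_fract (const p)"
        by (simp only: to_fract_mult w(2)[symmetric] mult_ac)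
      also have "\<dots> = to_fract (const p * v)" by (simp only: to_fract_mult v(2) mult_ac)
      finally have "u * w = const p * v" by (simp only: to_fract_eq_iff)
      then show ?thesis using u A fixed_dvd_const_mult[OF v(1)] by (auto simp: conductor_def)
    qed
    ultimately show "\<exists>w\<in>H. \<not> fixed_dvd p w \<and> A \<subseteq> conductor f p w" using w(1) by blast
  next
    assume "\<exists>w\<in>H. \<not> fixed_dvd p w \<and> A \<subseteq> conductor f p w"
    then obtain w where w: "w \<in> H" "\<not> fixed_dvd p w" "A \<subseteq> conductor f p w" by blast
    let ?z = "to_fract w / to_fract (const p)"
    have "?z \<in> quotient_group H" using w(1) p_mem unfolding quotient_group_def by blast
    moreover have "?z * to_fract u \<in> to_fract ` H" if "u \<in> A \<union> {const p}" for u
    proof -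
      have "u \<in> conductor f p w" using that w p_in_conductor by blast
      then obtain v where v: "v \<in> H" "u * w = const p * v"
        using w(1) by (rule conductorE)
      have "to_fract w * to_fract u = to_fract (const p) * to_fract v"
        using v(2) by (metis to_fract_mult mult.commute)
      then have "?z * to_fract u = to_fract v"
        by (simp only: times_divide_eq_left nonzero_mult_div_cancel_left[OF p0])
      with v(1) show ?thesis by blast
    qed
    ultimately have "?z \<in> ?I" unfolding monoid_inverse_def elt_set_times_def by blast
    moreover have "?z \<notin> to_fract ` H"
    proof
      assume "?z \<in> to_fract ` H"
      then obtain v where v: "v \<in> H" "?z = to_fract v" by blast
      then have "to_fract w = to_fract (const p * v)"
        by (simp only: to_fract_mult nonzero_divide_eq_eq[OF p0] mult.commute)
      then have "w = const p * v" by (simp only: to_fract_eq_iff)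
      with w(2) fixed_dvd_const_mult[OF v(1)] show False by simp
    qed
    ultimately show "\<not> ?I \<subseteq> to_fract ` H" by blast
  qed
  moreover have "A \<union> {const p} \<subseteq> H" using A p_mem by blast
  ultimately show ?thesis
    using v_closure_psubset_iff[OF div_closed_1 div_closed_mult] by metis
qed

end

section \<open>Compatible sets and the minimal primes containing \<open>p\<close>\<close>

theorem lemma4p8:
  fixes \<Q> :: "'a::{factorial_semiring, idom} set"
    and f :: "'a fract poly" and p :: 'a and \<S> A :: "'a fract poly set"
  assumes "system_of_reps (UNIV - {0}) {q. prime_elem q} \<Q>"
    and "f \<in> int_valued - {0}"
    and "system_of_reps (div_closed f) (atoms_of (div_closed f) - range const) \<S>"
    and "const p \<in> atoms_of (div_closed f)"
    and "A \<subseteq> div_closed f"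
  shows "(compatible \<Q> f p A \<longleftrightarrow>
            v_closure (div_closed f) (to_fract ` (A \<union> {const p})) \<subset> to_fract ` div_closed f) \<and>
         {P \<in> min_primes (div_closed f). const p \<in> P} =
            {(Q \<union> {const p}) * div_closed f | Q. Q \<subseteq> \<S> \<and> max_compatible \<Q> f p \<S> Q}"
proof -
  interpret constant_prime f p
    using assms(2,4) prime_elem_if_const_atom by unfold_locales (auto simp: atoms_of_def)
  have compat: "compatible \<Q> f p B \<longleftrightarrow> (\<exists>w\<in>H. \<not> fixed_dvd p w \<and> B \<subseteq> conductor f p w)"
    if "B \<subseteq> H" for B
    using compatible_iff[OF assms(1) prime_p that] that unfolding conductor_def by blast
  have \<S>H: "\<S> \<subseteq> H" using assms(3) by (auto simp: system_of_reps_def atoms_of_def)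
  have compat_prime: "\<exists>w\<in>H. \<not> fixed_dvd p w \<and> prime_s_ideal H (conductor f p w) \<and> B \<subseteq> conductor f p w"
    if B: "B \<subseteq> H" "compatible \<Q> f p B" for B
  proof -
    obtain w where w: "w \<in> H" "\<not> fixed_dvd p w" "B \<subseteq> conductor f p w"
      using compat B by blast
    obtain v where v: "v \<in> H" "\<not> fixed_dvd p (w * v)" "prime_s_ideal H (conductor f p (w * v))"
      using ex_prime_conductor w by blast
    with w show ?thesis using conductor_mono[OF w(1) v(1)] div_closed_mult by blast
  qed
  have compat_inter: "compatible \<Q> f p (conductor f p w \<inter> \<S>)" if "w \<in> H" "\<not> fixed_dvd p w" for w
    using that compat \<S>H by (metis inf.cobounded1 inf.coboundedI2)
  have "{P \<in> min_primes H. const p \<in> P} =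
    {(Q \<union> {const p}) * H | Q. Q \<subseteq> \<S> \<and> max_compatible \<Q> f p \<S> Q}"
  proof (intro subset_antisym subsetI)
    fix P assume "P \<in> {P \<in> min_primes H. const p \<in> P}"
    then have P: "prime_s_ideal H P" "const p \<in> P"
      "\<And>P'. prime_s_ideal H P' \<Longrightarrow> P' \<noteq> {} \<Longrightarrow> P' \<subseteq> P \<Longrightarrow> P' = P"
      by (auto simp: min_primes_def)
    obtain w where w: "w \<in> H" "\<not> fixed_dvd p w" "prime_s_ideal H (conductor f p w)"
      "conductor f p w \<subseteq> P"
      using ex_conductor_subset_prime[OF P(1,2)] by blast
    \<comment> \<open>A minimal prime equals any prime conductor inside it.\<close>
    have Pw: "P = conductor f p w" using P(3)[OF w(3) _ w(4)] p_in_conductor[OF w(1)] by blast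
    have gen: "P = ((P \<inter> \<S>) \<union> {const p}) * H"
      using prime_conductor_eq[OF w(1-3) assms(3)] Pw by simp
    \<comment> \<open>A larger compatible set lies in a prime conductor, which contains the
      generators of \<open>P\<close> and hence \<open>P\<close>; its own minimality makes it equal
      to \<open>P\<close>.\<close>
    have "A' = P \<inter> \<S>"
      if A': "P \<inter> \<S> \<subseteq> A'" "A' \<subseteq> \<S>" "compatible \<Q> f p A'" for A'
    proof -
      obtain v where v: "v \<in> H" "\<not> fixed_dvd p v" "prime_s_ideal H (conductor f p v)"
        "A' \<subseteq> conductor f p v"
        using compat_prime[of A'] A' \<S>H by blast
      have "(P \<inter> \<S>) \<union> {const p} \<subseteq> conductor f p v" using A'(1) v(4) p_in_conductor[OF v(1)] by blast
      then have "P \<subseteq> conductor f p v"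
        using gen set_times_subset_prime_s_ideal[OF v(3)] by metis
      then have "P = conductor f p v"
        using prime_conductor_min[OF v(1-3)] P(1,2) unfolding min_primes_def by blast
      with v(4) A' show ?thesis by blast
    qed
    then have "max_compatible \<Q> f p \<S> (P \<inter> \<S>)"
      using compat_inter[OF w(1,2)] Pw unfolding max_compatible_def by blast
    with gen show "P \<in> {(Q \<union> {const p}) * H | Q. Q \<subseteq> \<S> \<and> max_compatible \<Q> f p \<S> Q}" by blast
  next
    fix P assume "P \<in> {(Q \<union> {const p}) * H | Q. Q \<subseteq> \<S> \<and> max_compatible \<Q> f p \<S> Q}"
    then obtain Q where Q: "P = (Q \<union> {const p}) * H" "Q \<subseteq> \<S>" "compatible \<Q> f p Q"
      "\<And>A'. Q \<subseteq> A' \<Longrightarrow> A' \<subseteq> \<S> \<Longrightarrow> compatible \<Q> f p A' \<Longrightarrow> A' = Q"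
      by (auto simp: max_compatible_def)
    obtain w where w: "w \<in> H" "\<not> fixed_dvd p w" "prime_s_ideal H (conductor f p w)"
      "Q \<subseteq> conductor f p w"
      using compat_prime[of Q] Q \<S>H by blast
    \<comment> \<open>The left side is a compatible subset of \<open>\<S>\<close> containing
      \<open>Q\<close>, so maximality of \<open>Q\<close> applies.\<close>
    have "conductor f p w \<inter> \<S> = Q"
      using Q(2) w(4) compat_inter[OF w(1,2)] by (intro Q(4)) auto
    then have "P = conductor f p w" using prime_conductor_eq[OF w(1-3) assms(3)] Q(1) by simp
    then show "P \<in> {P \<in> min_primes H. const p \<in> P}"
      using prime_conductor_min[OF w(1-3)] p_in_conductor[OF w(1)] by simp
  qed
  then show ?thesis
    using compat[OF assms(5)] v_closure_psubset_iff_conductor[OF assms(5)] by blast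
qed

end
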